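(* Fix a positive integer $j$. Let $\mathcal{F}$ be a $j$-run-closed family of $j$-compatible s-partitions with size generating function $f(x)=\sum_{\pi\in\mathcal{F}}x^{\mathrm{size}(\pi)}$. Then \[ \Phi\big(f(x)\big)=\sum_{\pi\in\mathcal{F}}x^{\mathrm{size}(\pi)}y^{\mathrm{run}_j(\pi)}, \] where $\mathrm{run}_j(\pi)$ is the number of $j$-runs of $\pi$.
   Context: The run transform is $\Phi\big(f(x)\big)=\frac{1-x}{1-xy}\,f\!\left(\frac{x(1-x)}{1-xy}\right)$. A standard s-partition is a partition of $\{1,\dots,n\}$ ($n\ge0$) into a set of lists (blocks). It is $j$-compatible if every block has length divisible by $j$; its size is then $n/j$. A run is a block consisting of consecutive integers in increasing order; a $j$-run is a run whose length and last entry are both divisible by $j$. Deleting a run means removing that block and standardizing the remainder (relabeling order-preservingly by $1,2,\dots$); inserting the run $i+1,\dots,i+\ell$ ($0\le i\le n$) means increasing by $\ell$ every entry exceeding $i$ and adjoining $i+1,\dots,i+\ell$ as a new block. A $j$-run-closed family is a set of standard $j$-compatible s-partitions closed under insertion and deletion of $j$-runs. *)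

theory Defs
  imports
    "HOL-Library.Disjoint_Sets"
    "HOL-Computational_Algebra.Polynomial"
    "HOL-Computational_Algebra.Formal_Power_Series"
begin

text \<open>An s-partition is represented by its set of blocks, each block being a list.\<close>

definition entries :: "nat list set \<Rightarrow> nat set" where
  "entries P = (\<Union>b\<in>P. set b)"

text \<open>Injectivity of \<^const>\<open>set\<close> on \<open>P\<close> excludes two blocks that list the same
  entries in different orders; without it they would be identified in the image.\<close>

definition standard_spartition :: "nat list set \<Rightarrow> bool" where
  "standard_spartition P \<longleftrightarrow>
     (\<exists>n. partition_on {1..n} (set ` P)) \<and> inj_on set P \<and> (\<forall>b\<in>P. distinct b)"

definition compatible :: "nat \<Rightarrow> nat list set \<Rightarrow> bool" where
  "compatible j P \<longleftrightarrow> (\<forall>b\<in>P. j dvd length b)"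

definition spsize :: "nat \<Rightarrow> nat list set \<Rightarrow> nat" where
  "spsize j P = card (entries P) div j"

definition interval_block :: "nat \<Rightarrow> nat \<Rightarrow> nat list" where
  "interval_block i l = [i + 1..<i + l + 1]"

definition is_run :: "nat list \<Rightarrow> bool" where
  "is_run b \<longleftrightarrow> (\<exists>i l. 0 < l \<and> b = interval_block i l)"

definition is_jrun :: "nat \<Rightarrow> nat list \<Rightarrow> bool" where
  "is_jrun j b \<longleftrightarrow> is_run b \<and> j dvd length b \<and> j dvd last b"

definition num_jruns :: "nat \<Rightarrow> nat list set \<Rightarrow> nat" where
  "num_jruns j P = card {b \<in> P. is_jrun j b}"

definition standardize :: "nat list set \<Rightarrow> nat list set" where
  "standardize Q = map (\<lambda>k. card {m \<in> entries Q. m \<le> k}) ` Q"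

definition delete_run :: "nat list \<Rightarrow> nat list set \<Rightarrow> nat list set" where
  "delete_run b P = standardize (P - {b})"

definition insert_run :: "nat \<Rightarrow> nat \<Rightarrow> nat list set \<Rightarrow> nat list set" where
  "insert_run i l P =
     insert (interval_block i l) (map (\<lambda>k. if i < k then k + l else k) ` P)"

text \<open>For a standard s-partition \<open>P\<close> of \<open>{1..n}\<close>, \<open>card (entries P)\<close> is \<open>n\<close>.\<close>

definition run_closed_family :: "nat \<Rightarrow> nat list set set \<Rightarrow> bool" where
  "run_closed_family j F \<longleftrightarrow>
     (\<forall>P\<in>F. standard_spartition P \<and> compatible j P) \<and>
     (\<forall>P\<in>F. \<forall>i l. i \<le> card (entries P) \<and> is_jrun j (interval_block i l)
        \<longrightarrow> insert_run i l P \<in> F) \<and>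
     (\<forall>P\<in>F. \<forall>b\<in>P. is_jrun j b \<longrightarrow> delete_run b P \<in> F)"

text \<open>The series \<open>\<Sum>P\<in>F. x ^ size P * w P\<close>, as a formal power series in \<open>x\<close>; see
  \<open>finite_spsize_level\<close> for the finiteness of the coefficient sums.\<close>

definition weighted_gf ::
  "nat \<Rightarrow> nat list set set \<Rightarrow> (nat list set \<Rightarrow> 'a::comm_ring_1) \<Rightarrow> 'a fps" where
  "weighted_gf j F w = Abs_fps (\<lambda>n. \<Sum>P\<in>{P\<in>F. spsize j P = n}. w P)"

definition size_gf :: "nat \<Rightarrow> nat list set set \<Rightarrow> int fps" where
  "size_gf j F = weighted_gf j F (\<lambda>P. 1)"

text \<open>The variable \<open>y\<close> is the polynomial variable of the coefficient ring, so that
  series in \<open>x\<close> and \<open>y\<close> live in \<open>\<int>[y][[x]]\<close>.\<close>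

definition yvar :: "int poly" where
  "yvar = [:0, 1:]"

text \<open>As \<^typ>\<open>int poly\<close> is not a field, \<open>1 / (1 - x y)\<close> is taken as the ring inverse with
  constant term \<open>1\<close>.\<close>

definition inv_one_minus_xy :: "int poly fps" where
  "inv_one_minus_xy = fps_right_inverse (1 - fps_X * fps_const yvar) 1"

definition run_transform :: "int fps \<Rightarrow> int poly fps" where
  "run_transform f =
     (1 - fps_X) * inv_one_minus_xy *
     (Abs_fps (\<lambda>n. [:fps_nth f n:]) oo (fps_X * (1 - fps_X) * inv_one_minus_xy))"

lemma inv_one_minus_xy: "(1 - fps_X * fps_const yvar) * inv_one_minus_xy = 1"
  unfolding inv_one_minus_xy_def by (rule fps_right_inverse) simp

lemma finite_spsize_level:
  assumes "0 < j" "\<And>P. P \<in> F \<Longrightarrow> standard_spartition P"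
  shows "finite {P\<in>F. spsize j P = n}"
proof (rule finite_subset)
  show "{P\<in>F. spsize j P = n} \<subseteq> Pow {xs. set xs \<subseteq> {1..(n + 1) * j} \<and> distinct xs}"
  proof
    fix P assume P: "P \<in> {P\<in>F. spsize j P = n}"
    then obtain m where m: "partition_on {1..m} (set ` P)" and d: "\<forall>b\<in>P. distinct b"
      using assms(2) unfolding standard_spartition_def by blast
    have e: "entries P = {1..m}"
      using partition_onD1[OF m] unfolding entries_def by simp
    then have "m div j = n"
      using P unfolding spsize_def by simp
    then have "m = n * j + m mod j"
      using div_mult_mod_eq[of m j] by simp
    moreover have "m mod j < j"
      using assms(1) by simp
    ultimately have le: "m \<le> (n + 1) * j"
      unfolding distrib_right by linarith
    have "set b \<subseteq> {1..(n + 1) * j}" if "b \<in> P" for b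
    proof -
      have "set b \<subseteq> {1..m}"
        using e that unfolding entries_def by blast
      also have "\<dots> \<subseteq> {1..(n + 1) * j}"
        using le by (intro atLeastatMost_subset_iff[THEN iffD2]) blast
      finally show ?thesis .
    qed
    then show "P \<in> Pow {xs. set xs \<subseteq> {1..(n + 1) * j} \<and> distinct xs}"
      using d by blast
  qed
  show "finite (Pow {xs. set xs \<subseteq> {1..(n + 1) * j} \<and> distinct xs})"
    using finite_subset_distinct[of "{1..(n + 1) * j}"] by simp
qed

end

theory Submission
  imports Defs
begin

text \<open>
  Put \<open>y = 1 + z\<close>, so that the right-hand side counts members of the family with some of their
  \<open>j\<close>-runs marked, each mark having weight \<open>z\<close>. Let \<open>N m r k\<close> be the number of members with \<open>k\<close>
  marked runs of total size \<open>r\<close> and a remainder of size \<open>m\<close>. Deleting one distinguished marked run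
  of size \<open>l\<close> is inverted by inserting it at one of the \<open>m + k\<close> places that are not inside the other
  \<open>k - 1\<close> marked runs, whence \<open>k * N m r k = (m + k) * (\<Sum>l=1..r. N m (r - l) (k - 1))\<close>. So
  \<open>N m r k\<close> is the number of members of size \<open>m\<close> times \<open>(m + k) choose k\<close> times the number of
  compositions of \<open>r\<close> into \<open>k\<close> parts, which is the coefficient of \<open>x ^ r * z ^ k\<close> in the
  \<open>(m + 1)\<close>-st power of \<open>1 / (1 - z * x / (1 - x)) = (1 - x) / (1 - x * y)\<close>.
\<close>

subsection \<open>Inserting and deleting runs\<close>

lemma length_interval_block [simp]: "length (interval_block i l) = l"
  by (simp add: interval_block_def)

lemma set_interval_block: "set (interval_block i l) = {i<..i + l}"
  by (auto simp: interval_block_def)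

lemma last_interval_block: "0 < l \<Longrightarrow> last (interval_block i l) = i + l"
  by (simp add: interval_block_def)

lemma hd_interval_block: "0 < l \<Longrightarrow> hd (interval_block i l) = Suc i"
  by (simp add: interval_block_def del: upt_Suc)

text \<open>The offset before the first entry is the last entry minus the length, so
  \<open>j\<close> divides it too. Thus a \<open>j\<close>-run is given by a place \<open>p\<close>
  and a size \<open>q\<close>, both in units of \<open>j\<close>.\<close>

lemma is_jrun_iff:
  assumes "0 < j"
  shows "is_jrun j b \<longleftrightarrow> (\<exists>p q. 0 < q \<and> b = interval_block (j * p) (j * q))"
proof
  assume "is_jrun j b"
  then obtain i l where il: "0 < l" "b = interval_block i l" "j dvd l" "j dvd i + l"
    unfolding is_jrun_def is_run_def by (auto simp: last_interval_block)
  then have "j dvd i" by (simp add: dvd_add_left_iff)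
  with il show "\<exists>p q. 0 < q \<and> b = interval_block (j * p) (j * q)"
    by (metis dvdE nat_0_less_mult_iff)
next
  assume "\<exists>p q. 0 < q \<and> b = interval_block (j * p) (j * q)"
  then obtain p q where "0 < j * q" "b = interval_block (j * p) (j * q)"
    using assms by auto
  then show "is_jrun j b"
    unfolding is_jrun_def is_run_def
    by (auto simp: last_interval_block simp del: mult_eq_0_iff nat_0_less_mult_iff)
qed

lemma standard_spartition_finite:
  assumes "standard_spartition P"
  shows "finite P"
proof -
  obtain n where "partition_on {1..n} (set ` P)" "inj_on set P"
    using assms unfolding standard_spartition_def by blast
  then show ?thesis
    by (metis finite_atLeastAtMost finite_elements finite_imageD)
qed

lemma standard_spartition_disjoint:
  assumes "standard_spartition P" "b \<in> P" "c \<in> P" "b \<noteq> c"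
  shows "set b \<inter> set c = {}"
proof -
  obtain n where "partition_on {1..n} (set ` P)" "inj_on set P"
    using assms unfolding standard_spartition_def by blast
  with assms show ?thesis
    by (metis disjointD imageI inj_onD partition_onD2)
qed

lemma standard_spartition_entries:
  assumes "standard_spartition P"
  shows "entries P = {1..card (entries P)}"
proof -
  obtain n where "partition_on {1..n} (set ` P)"
    using assms unfolding standard_spartition_def by blast
  then have "entries P = {1..n}"
    using partition_onD1 unfolding entries_def by metis
  then show ?thesis by simp
qed

lemma card_entries:
  assumes "standard_spartition P"
  shows "card (entries P) = sum length P"
proof -
  have "card (entries P) = (\<Sum>b\<in>P. card (set b))"
    unfolding entries_def
    using assms standard_spartition_finite standard_spartition_disjoint
    by (intro card_UN_disjoint) auto
  also have "\<dots> = sum length P"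
    using assms unfolding standard_spartition_def
    by (intro sum.cong) (auto simp: distinct_card)
  finally show ?thesis .
qed

section \<open>Relabelling maps behind insertion and deletion\<close>

definition shift_up :: "nat \<Rightarrow> nat \<Rightarrow> nat \<Rightarrow> nat" where
  "shift_up i l k = (if i < k then k + l else k)"

text \<open>Left inverse of \<open>shift_up i l\<close>, and right inverse on entries outside
  \<open>{i<..i + l}\<close>.\<close>

definition shift_down :: "nat \<Rightarrow> nat \<Rightarrow> nat \<Rightarrow> nat" where
  "shift_down i l k = (if i < k then k - l else k)"

lemma insert_run_eq:
  "insert_run i l P = insert (interval_block i l) (map (shift_up i l) ` P)"
  unfolding insert_run_def shift_up_def ..

lemma shift_down_up [simp]: "map (shift_down i l) (map (shift_up i l) b) = b"
  by (simp add: shift_up_def shift_down_def map_idI)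

lemma shift_up_down:
  assumes "set b \<inter> {i<..i + l} = {}"
  shows "map (shift_up i l) (map (shift_down i l) b) = b"
  unfolding list.map_comp
  by (rule map_idI) (use assms in \<open>auto simp: shift_up_def shift_down_def disjoint_iff\<close>)

lemma inj_map_shift_up: "inj_on (map (shift_up i l)) B"
  by (rule inj_on_inverseI[of _ "map (shift_down i l)"]) (rule shift_down_up)

text \<open>For positive \<open>l\<close> the value \<open>i + 1\<close> is skipped by
  \<open>shift_up i l\<close>. Hence the inserted block is new: it can be counted separately and
  removed again.\<close>

lemma interval_block_notin_shift_up:
  assumes "0 < l"
  shows "interval_block i l \<notin> map (shift_up i l) ` B"
proof
  assume "interval_block i l \<in> map (shift_up i l) ` B"
  then obtain b where "interval_block i l = map (shift_up i l) b" by blast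
  then have "i + 1 \<in> shift_up i l ` set b"
    using assms by (metis list.set_map set_interval_block greaterThanAtMost_iff
        less_add_one add_le_cancel_left Suc_leI One_nat_def)
  then show False using assms by (auto simp: shift_up_def split: if_splits)
qed

text \<open>The hypothesis keeps the cut after \<open>i\<close> out of the interior of the block, so
  its entries all lie on one side of the cut and move together.\<close>

lemma map_shift_up_interval_block:
  assumes "\<not> (p < i \<and> i < p + q)"
  shows "map (shift_up i l) (interval_block p q) =
    interval_block (if i \<le> p then p + l else p) q"
  using assms
  by (auto intro!: nth_equalityI simp: interval_block_def shift_up_def simp del: upt_Suc)

text \<open>Standardizing replaces an entry by its rank among the remaining ones. The removed
  entries fill an interval, so ranks drop by \<open>l\<close> above it and are unchanged below
  it.\<close>

lemma delete_run_eq: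
  assumes P: "standard_spartition P" and b: "interval_block i l \<in> P"
  shows "delete_run (interval_block i l) P = map (shift_down i l) ` (P - {interval_block i l})"
proof -
  let ?b = "interval_block i l"
  define n where "n = card (entries P)"
  have n: "entries P = {1..n}"
    unfolding n_def by (rule standard_spartition_entries[OF P])
  have disj: "set c \<inter> {i<..i + l} = {}" if "c \<in> P - {?b}" for c
    using standard_spartition_disjoint[OF P _ b, of c] that by (auto simp: set_interval_block)
  have "entries P = entries (P - {?b}) \<union> {i<..i + l}"
    using b unfolding entries_def by (auto simp: set_interval_block)
  moreover have "entries (P - {?b}) \<inter> {i<..i + l} = {}"
    using disj unfolding entries_def by blast
  ultimately have e: "entries (P - {?b}) = {1..n} - {i<..i + l}"
    using n by blast
  have "card {m \<in> entries (P - {?b}). m \<le> k} = shift_down i l k"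
    if "c \<in> P - {?b}" "k \<in> set c" for c k
  proof -
    have "k \<in> entries (P - {?b})" using that unfolding entries_def by blast
    then have k: "1 \<le> k" "k \<le> n" "k \<notin> {i<..i + l}" unfolding e by auto
    show ?thesis
    proof (cases "i < k")
      case True
      then have "{m \<in> entries (P - {?b}). m \<le> k} = {1..k} - {i<..i + l}"
        using k unfolding e by auto
      also have "card \<dots> = k - l"
        using k True by (subst card_Diff_subset) auto
      finally show ?thesis using True by (simp add: shift_down_def)
    next
      case False
      then have "{m \<in> entries (P - {?b}). m \<le> k} = {1..k}"
        using k unfolding e by auto
      then show ?thesis using False by (simp add: shift_down_def)
    qed
  qed
  then show ?thesis
    unfolding delete_run_def standardize_def by (intro image_cong map_cong refl) auto
qed

lemma delete_insert_run:
  assumes "standard_spartition (insert_run i l P)" "0 < l"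
  shows "delete_run (interval_block i l) (insert_run i l P) = P"
  using delete_run_eq[OF assms(1)] interval_block_notin_shift_up[OF assms(2), of i P]
  by (simp add: insert_run_eq image_image del: map_map)

text \<open>Stated for a subset \<open>S\<close> so that it serves for the marked blocks as well as
  for the whole s-partition.\<close>

lemma shift_up_down_image:
  assumes "standard_spartition P" "interval_block i l \<in> P" "S \<subseteq> P"
  shows "map (shift_up i l) ` map (shift_down i l) ` (S - {interval_block i l})
    = S - {interval_block i l}"
proof -
  have "map (shift_up i l) (map (shift_down i l) c) = c" if "c \<in> S - {interval_block i l}" for c
  proof (rule shift_up_down)
    show "set c \<inter> {i<..i + l} = {}"
      using standard_spartition_disjoint[OF assms(1) _ assms(2), of c] that assms(3)
      by (auto simp: set_interval_block)
  qed
  then show ?thesis by (simp add: image_image del: map_map)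
qed

lemma insert_delete_run:
  assumes "standard_spartition P" "interval_block i l \<in> P"
  shows "insert_run i l (delete_run (interval_block i l) P) = P"
  using shift_up_down_image[OF assms order_refl] assms
  by (simp add: delete_run_eq insert_run_eq insert_absorb del: map_map)

lemma card_entries_insert_run:
  assumes "standard_spartition P" "standard_spartition (insert_run i l P)" "0 < l"
  shows "card (entries (insert_run i l P)) = card (entries P) + l"
  using assms interval_block_notin_shift_up[OF assms(3), of i P]
  by (simp add: card_entries insert_run_eq standard_spartition_finite
      sum.reindex[OF inj_map_shift_up])

subsection \<open>Compositions and powers of the transform factor\<close>

text \<open>The number of compositions of \<open>r\<close> into \<open>k\<close> positive parts.\<close>

fun ncomp :: "nat \<Rightarrow> nat \<Rightarrow> nat" where
  "ncomp r 0 = (if r = 0 then 1 else 0)"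
| "ncomp r (Suc k) = (\<Sum>l=1..r. ncomp (r - l) k)"

lemma ncomp_eq_0: "r < k \<Longrightarrow> ncomp r k = 0"
  by (induction r k rule: ncomp.induct) auto

text \<open>This is the series \<open>\<Sum>k. a k * (z * x / (1 - x)) ^ k\<close>. The coefficient
  sum stops at \<open>r\<close> because \<open>r\<close> has no composition into more than
  \<open>r\<close> positive parts.\<close>

definition ncomp_series :: "'a::comm_ring_1 \<Rightarrow> (nat \<Rightarrow> nat) \<Rightarrow> 'a fps" where
  "ncomp_series z a = Abs_fps (\<lambda>r. \<Sum>k\<le>r. of_nat (a k * ncomp r k) * z ^ k)"

lemma ncomp_series_nth:
  assumes "r \<le> n"
  shows "fps_nth (ncomp_series z a) r = (\<Sum>k\<le>n. of_nat (a k * ncomp r k) * z ^ k)"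
  unfolding ncomp_series_def fps_nth_Abs_fps
  using assms by (intro sum.mono_neutral_left) (auto simp: ncomp_eq_0)

lemma ncomp_series_add:
  "ncomp_series z (\<lambda>k. a k + b k) = ncomp_series z a + ncomp_series z b"
  by (simp add: fps_eq_iff ncomp_series_def distrib_right sum.distrib)

text \<open>The \<open>Abs_fps\<close> factor is \<open>x / (1 - x)\<close>. Multiplying by it
  prepends one positive part to each composition, and the factor \<open>z\<close> records the
  additional part.\<close>

lemma ncomp_series_shift:
  fixes z :: "'a::comm_ring_1"
  shows "fps_const z * Abs_fps (\<lambda>n. if n = 0 then 0 else 1) * ncomp_series z a
    = ncomp_series z (case_nat 0 a)"
proof (rule fps_ext)
  fix r
  have "fps_nth (fps_const z * Abs_fps (\<lambda>n. if n = 0 then 0 else 1) * ncomp_series z a) r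
      = z * (\<Sum>l=0..r. (if l = 0 then 0 else 1) * fps_nth (ncomp_series z a) (r - l))"
    by (simp only: mult.assoc fps_mult_left_const_nth) (simp only: fps_mult_nth fps_nth_Abs_fps)
  also have "(\<Sum>l=0..r. (if l = 0 then 0 else 1) * fps_nth (ncomp_series z a) (r - l))
      = (\<Sum>l=1..r. fps_nth (ncomp_series z a) (r - l))"
    by (intro sum.mono_neutral_cong_right) auto
  also have "\<dots> = (\<Sum>l=1..r. \<Sum>k\<le>r. of_nat (a k * ncomp (r - l) k) * z ^ k)"
    by (intro sum.cong refl ncomp_series_nth) simp
  also have "\<dots> = (\<Sum>k\<le>r. of_nat (a k * ncomp r (Suc k)) * z ^ k)"
    by (subst sum.swap) (simp add: sum_distrib_left sum_distrib_right)
  \<comment> \<open>The new term \<open>k = 0\<close> vanishes by \<open>case_nat 0 a\<close>. The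
    upper limit \<open>Suc r\<close> is admissible, since \<open>ncomp_series_nth\<close> allows any
    limit from \<open>r\<close> on.\<close>
  also have "z * \<dots> = (\<Sum>k\<le>Suc r. of_nat (case_nat 0 a k * ncomp r k) * z ^ k)"
    by (subst sum.atMost_Suc_shift) (simp add: sum_distrib_left mult_ac)
  also have "\<dots> = fps_nth (ncomp_series z (case_nat 0 a)) r"
    by (rule ncomp_series_nth[symmetric]) simp
  finally show "fps_nth (fps_const z * Abs_fps (\<lambda>n. if n = 0 then 0 else 1) * ncomp_series z a) r
      = fps_nth (ncomp_series z (case_nat 0 a)) r" .
qed

text \<open>Write \<open>G\<close> for \<open>z * x / (1 - x)\<close>, so that \<open>A\<close> is
  the inverse of \<open>1 - G\<close>. By Pascal's rule the binomial sequence for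
  \<open>Suc m\<close> is the one for \<open>m\<close> plus its own shift, so passing from
  \<open>m\<close> to \<open>Suc m\<close> multiplies the series by \<open>A\<close>.\<close>

lemma ncomp_series_binomial:
  fixes A :: "'a::comm_ring_1 fps"
  assumes A: "A * (1 - fps_const z * Abs_fps (\<lambda>n. if n = 0 then 0 else 1)) = 1"
  shows "ncomp_series z (\<lambda>k. (m + k) choose k) = A ^ Suc m"
proof -
  define G where "G = fps_const z * Abs_fps (\<lambda>n. if n = 0 then 0 else 1)"
  have step: "ncomp_series z a = A * ncomp_series z b" if "a = (\<lambda>k. b k + case_nat 0 a k)" for a b
  proof -
    have "ncomp_series z a = ncomp_series z b + G * ncomp_series z a"
      by (subst that) (simp only: ncomp_series_add ncomp_series_shift G_def)
    then have "(1 - G) * ncomp_series z a = ncomp_series z b"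
      unfolding left_diff_distrib mult_1_left diff_eq_eq .
    then have "A * ncomp_series z b = (A * (1 - G)) * ncomp_series z a"
      by (simp add: mult.assoc)
    then show ?thesis using A unfolding G_def by simp
  qed
  show ?thesis
  proof (induction m)
    case 0
    \<comment> \<open>The sequence 1, 0, 0, ... has series 1. The constant sequence
      \<open>k choose k\<close> is this sequence plus its own shift, so its series is
      \<open>A\<close>.\<close>
    have "fps_nth (ncomp_series z (\<lambda>k. if k = 0 then 1 else 0)) r = fps_nth 1 r" for r
    proof -
      have "fps_nth (ncomp_series z (\<lambda>k. if k = 0 then 1 else 0)) r
          = (\<Sum>k\<in>{0}. of_nat ((if k = 0 then 1 else 0) * ncomp r k) * z ^ k)"
        unfolding ncomp_series_def fps_nth_Abs_fps by (intro sum.mono_neutral_right) auto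
      then show ?thesis by simp
    qed
    then have "ncomp_series z (\<lambda>k. if k = 0 then 1 else 0) = 1"
      by (intro fps_ext)
    moreover have "ncomp_series z (\<lambda>k. k choose k) =
        A * ncomp_series z (\<lambda>k. if k = 0 then 1 else 0)"
      by (rule step) (auto split: nat.split)
    ultimately show ?case by simp
  next
    case (Suc m)
    have "ncomp_series z (\<lambda>k. (Suc m + k) choose k) = A * ncomp_series z (\<lambda>k. (m + k) choose k)"
      by (rule step) (auto split: nat.split)
    then show ?case using Suc by simp
  qed
qed

text \<open>Formally \<open>A * h(x * A)\<close> is the sum of
  \<open>h_m * x ^ m * A ^ (m + 1)\<close>; the factor \<open>x ^ m\<close> moves the coefficient to
  index \<open>n - m\<close>.\<close>

lemma fps_mult_compose_nth:
  fixes h A :: "'a::comm_ring_1 fps"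
  shows "fps_nth (A * (h oo (fps_X * A))) n = (\<Sum>m\<le>n. fps_nth h m * fps_nth (A ^ Suc m) (n - m))"
proof -
  have "fps_nth (A * (h oo (fps_X * A))) n
      = (\<Sum>i=0..n. \<Sum>m=0..n - i. fps_nth A i * (fps_nth h m * fps_nth ((fps_X * A) ^ m) (n - i)))"
    by (simp add: fps_mult_nth fps_compose_nth sum_distrib_left)
  \<comment> \<open>The factor \<open>x ^ m\<close> kills the terms with \<open>m > n - i\<close>.
    The inner range becomes independent of \<open>i\<close>, and the sums can be swapped.\<close>
  also have "\<dots> = (\<Sum>i=0..n. \<Sum>m\<le>n. fps_nth A i * (fps_nth h m * fps_nth ((fps_X * A) ^ m) (n - i)))"
    by (intro sum.cong refl sum.mono_neutral_left)
      (auto simp: power_mult_distrib fps_X_power_mult_nth)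
  also have "\<dots> = (\<Sum>m\<le>n. fps_nth h m * fps_nth (A * (fps_X * A) ^ m) n)"
    by (subst sum.swap) (simp add: fps_mult_nth sum_distrib_left mult_ac)
  also have "\<dots> = (\<Sum>m\<le>n. fps_nth h m * fps_nth (A ^ Suc m) (n - m))"
  proof (intro sum.cong refl)
    fix m assume "m \<in> {..n}"
    have "A * (fps_X * A) ^ m = fps_X ^ m * A ^ Suc m"
      by (simp add: power_mult_distrib mult_ac)
    then show "fps_nth h m * fps_nth (A * (fps_X * A) ^ m) n =
        fps_nth h m * fps_nth (A ^ Suc m) (n - m)"
      using \<open>m \<in> {..n}\<close> by (simp add: fps_X_power_mult_nth del: power_Suc)
  qed
  finally show ?thesis .
qed

text \<open>Multiplying out, \<open>(1 - x) * (1 - (y - 1) * x / (1 - x)) = 1 - x * y\<close>. So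
  the factor of the transform can serve as \<open>A\<close> in \<open>ncomp_series_binomial\<close>
  with \<open>z = y - 1\<close>.\<close>

lemma run_transform_factor:
  "(1 - fps_X) * inv_one_minus_xy *
    (1 - fps_const (yvar - 1) * Abs_fps (\<lambda>n. if n = 0 then 0 else 1)) = 1"
proof -
  let ?G = "Abs_fps (\<lambda>n. if n = 0 then 0 else 1) :: int poly fps"
  have G: "(1 - fps_X) * ?G = fps_X"
    by (auto simp: fps_eq_iff left_diff_distrib)
  have "(1 - fps_X) * (1 - fps_const (yvar - 1) * ?G) =
      1 - fps_X - fps_const (yvar - 1) * ((1 - fps_X) * ?G)"
    by (simp add: algebra_simps)
  also have "\<dots> = 1 - fps_X * fps_const yvar"
    unfolding G by (simp add: algebra_simps flip: fps_const_sub)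
  finally have "(1 - fps_X) * (1 - fps_const (yvar - 1) * ?G) = 1 - fps_X * fps_const yvar" .
  then show ?thesis
    using inv_one_minus_xy by (simp add: mult_ac)
qed

subsection \<open>Marked runs\<close>

text \<open>Pairs of an s-partition with \<open>k\<close> of its \<open>j\<close>-runs marked, where \<open>r\<close> is the size of the
  marked part and \<open>m\<close> that of the remainder.\<close>

definition marked ::
  "nat \<Rightarrow> nat list set set \<Rightarrow> nat \<Rightarrow> nat \<Rightarrow> nat \<Rightarrow> (nat list set \<times> nat list set) set" where
  "marked j F m r k = {(P, S). P \<in> F \<and> S \<subseteq> {b \<in> P. is_jrun j b} \<and> card S = k \<and>
     sum length S = j * r \<and> spsize j P = m + r}"

text \<open>The places \<open>j * i\<close> at which a run can be inserted without breaking a marked one.\<close>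

definition gaps :: "nat \<Rightarrow> nat list set \<Rightarrow> nat \<Rightarrow> nat set" where
  "gaps j S n = {i. i \<le> n \<and> (\<forall>b\<in>S. \<not> (j * i \<in> set b \<and> j * i + 1 \<in> set b))}"

lemma gap_iff:
  assumes "0 < j"
  shows "j * i \<in> set (interval_block (j * p) (j * q)) \<and>
      j * i + 1 \<in> set (interval_block (j * p) (j * q)) \<longleftrightarrow> p < i \<and> i < p + q"
proof -
  have "j * i + 1 \<le> j * p + j * q \<longleftrightarrow> j * i < j * (p + q)"
    by (simp add: distrib_left Suc_le_eq)
  moreover have "j * p < j * i + 1 \<longleftrightarrow> p \<le> i"
    using assms by (simp add: less_Suc_eq_le)
  moreover have "j * i \<le> j * p + j * q \<longleftrightarrow> i \<le> p + q"
    using assms by (simp flip: distrib_left)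
  ultimately show ?thesis using assms by (auto simp: set_interval_block)
qed

text \<open>There are \<open>m + r + 1\<close> places in all. A marked run of size \<open>q\<close>
  blocks its \<open>q - 1\<close> interior places, and distinct marked runs block disjoint sets. So
  \<open>r - card S\<close> places are lost.\<close>

lemma card_gaps:
  assumes j: "0 < j" and P: "standard_spartition P"
    and S: "S \<subseteq> {b \<in> P. is_jrun j b}" "sum length S = j * r"
    and n: "card (entries P) = j * (m + r)"
  shows "card (gaps j S (m + r)) = Suc (m + card S)"
proof -
  \<comment> \<open>The places strictly inside \<open>b\<close>, at which an insertion would break
    it.\<close>
  define I where "I b = {i. j * i \<in> set b \<and> j * i + 1 \<in> set b}" for b
  have finS: "finite S"
    using standard_spartition_finite[OF P] S(1) finite_subset by fastforce
  have I: "finite (I b) \<and> j * Suc (card (I b)) = length b \<and> I b \<subseteq> {..m + r}" if "b \<in> S" for b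
  proof -
    have "is_jrun j b" using that S(1) by blast
    then obtain p q where q: "0 < q" and b: "b = interval_block (j * p) (j * q)"
      using is_jrun_iff[OF j] by blast
    have Ib: "I b = {p<..<p + q}"
      unfolding I_def b gap_iff[OF j] by auto
    have "set b \<subseteq> {1..j * (m + r)}"
      using that S(1) standard_spartition_entries[OF P, unfolded n] unfolding entries_def by blast
    moreover have "j * (p + q) \<in> set b"
      using q j by (simp add: b set_interval_block distrib_left)
    ultimately have "j * (p + q) \<le> j * (m + r)"
      by auto
    then have "p + q \<le> m + r" using j by simp
    then show ?thesis using q unfolding Ib by (auto simp: b)
  qed
  have disj: "I b \<inter> I c = {}" if "b \<in> S" "c \<in> S" "b \<noteq> c" for b c
    using standard_spartition_disjoint[OF P, of b c] that S(1) unfolding I_def by auto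
  have "gaps j S (m + r) = {..m + r} - (\<Union>b\<in>S. I b)"
    unfolding gaps_def I_def by auto
  moreover have "(\<Union>b\<in>S. I b) \<subseteq> {..m + r}" using I by blast
  ultimately have c: "card (gaps j S (m + r)) + card (\<Union>b\<in>S. I b) = Suc (m + r)"
    using card_mono[of "{..m + r}" "\<Union>b\<in>S. I b"]
    by (simp add: card_Diff_subset finite_subset)
  have "card (\<Union>b\<in>S. I b) = (\<Sum>b\<in>S. card (I b))"
    using finS I disj by (intro card_UN_disjoint) auto
  moreover have "j * (\<Sum>b\<in>S. Suc (card (I b))) = j * r"
    unfolding S(2)[symmetric] sum_distrib_left using I by (intro sum.cong) auto
  then have "(\<Sum>b\<in>S. card (I b)) + card S = r"
    using j by (simp add: sum.distrib sum_Suc)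
  ultimately show ?thesis using c by linarith
qed

context
  fixes j :: nat and F :: "nat list set set"
  assumes j: "0 < j" and F: "run_closed_family j F"
begin

section \<open>Effect of one insertion or deletion within the family\<close>

lemma family_standard: "P \<in> F \<Longrightarrow> standard_spartition P"
  using F unfolding run_closed_family_def by blast

text \<open>Compatibility makes the division in \<open>spsize\<close> exact.\<close>

lemma card_entries_family:
  assumes "P \<in> F"
  shows "card (entries P) = j * spsize j P"
proof -
  have "compatible j P"
    using F assms unfolding run_closed_family_def by blast
  then have "j dvd sum length P"
    unfolding compatible_def by (intro dvd_sum) blast
  then show ?thesis
    by (simp add: spsize_def card_entries[OF family_standard[OF assms]])
qed

lemma is_jrun_interval_block: "0 < l \<Longrightarrow> is_jrun j (interval_block (j * i) (j * l))"
  unfolding is_jrun_iff[OF j] by blast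

lemma insert_run_family:
  assumes "P \<in> F" "i \<le> spsize j P" "0 < l"
  shows "insert_run (j * i) (j * l) P \<in> F"
  using assms F is_jrun_interval_block unfolding run_closed_family_def
  by (simp add: card_entries_family)

lemma spsize_insert_run:
  assumes "P \<in> F" "i \<le> spsize j P" "0 < l"
  shows "spsize j (insert_run (j * i) (j * l) P) = spsize j P + l"
proof -
  have "j * spsize j (insert_run (j * i) (j * l) P) = j * (spsize j P + l)"
    using card_entries_insert_run[of P "j * i" "j * l"] assms j
    by (simp add: family_standard insert_run_family card_entries_family distrib_left
        flip: card_entries_family)
  then show ?thesis using j by simp
qed

lemma is_jrun_shift_up:
  assumes "is_jrun j b" "\<not> (j * i \<in> set b \<and> j * i + 1 \<in> set b)"
  shows "is_jrun j (map (shift_up (j * i) (j * l)) b)"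
proof -
  obtain p q where q: "0 < q" and b: "b = interval_block (j * p) (j * q)"
    using assms(1) is_jrun_iff[OF j] by blast
  have "\<not> (p < i \<and> i < p + q)"
    using assms(2) unfolding b gap_iff[OF j] .
  then have "\<not> (j * p < j * i \<and> j * i < j * p + j * q)"
    using j by (simp flip: distrib_left)
  then have "map (shift_up (j * i) (j * l)) b =
      interval_block (j * (if i \<le> p then p + l else p)) (j * q)"
    using j unfolding b by (subst map_shift_up_interval_block) (auto simp: distrib_left)
  then show ?thesis using q is_jrun_interval_block by simp
qed

text \<open>A run disjoint from the deleted one lies entirely on one side of it and therefore stays
  a run. The second conclusion makes \<open>i\<close> a gap for the remaining marks, which is needed
  to reinsert the deleted run.\<close>

lemma is_jrun_shift_down:
  assumes "is_jrun j b" "set b \<inter> {j * i<..j * i + j * l} = {}" "0 < l"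
  shows "is_jrun j (map (shift_down (j * i) (j * l)) b)"
    and "\<not> (j * i \<in> set (map (shift_down (j * i) (j * l)) b) \<and>
      j * i + 1 \<in> set (map (shift_down (j * i) (j * l)) b))"
proof -
  obtain p q where q: "0 < q" and b: "b = interval_block (j * p) (j * q)"
    using assms(1) is_jrun_iff[OF j] by blast
  have "p + q \<le> i \<or> i + l \<le> p"
  proof (rule ccontr)
    assume "\<not> (p + q \<le> i \<or> i + l \<le> p)"
    then have less: "j * i < j * (p + q)" "j * p < j * (i + l)" using j by auto
    \<comment> \<open>If the two intervals overlapped, this would be their first common
      entry.\<close>
    have "max (j * i) (j * p) + 1 \<in> set b \<inter> {j * i<..j * i + j * l}"
      using less q assms(3) j unfolding b set_interval_block distrib_left
      by (auto simp: Suc_le_eq max_def)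
    then show False using assms(2) by blast
  qed
  \<comment> \<open>The place of \<open>b\<close> after the deletion. Shifting the block at
    \<open>s\<close> up gives \<open>b\<close>, so shifting \<open>b\<close> down gives that
    block.\<close>
  define s where "s = (if p + q \<le> i then p else p - l)"
  have s: "\<not> (s < i \<and> i < s + q)" "p = (if i \<le> s then s + l else s)"
    using q \<open>p + q \<le> i \<or> i + l \<le> p\<close> unfolding s_def by auto
  have ns: "\<not> (j * s < j * i \<and> j * i < j * s + j * q)"
    using s(1) j by (simp flip: distrib_left)
  have "b = map (shift_up (j * i) (j * l)) (interval_block (j * s) (j * q))"
    unfolding b map_shift_up_interval_block[OF ns] using s(2) j by (simp add: distrib_left)
  then have down: "map (shift_down (j * i) (j * l)) b = interval_block (j * s) (j * q)"
    by (simp only: shift_down_up)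
  show "is_jrun j (map (shift_down (j * i) (j * l)) b)"
    unfolding down by (rule is_jrun_interval_block[OF q])
  show "\<not> (j * i \<in> set (map (shift_down (j * i) (j * l)) b) \<and>
      j * i + 1 \<in> set (map (shift_down (j * i) (j * l)) b))"
    unfolding down gap_iff[OF j] by (rule s(1))
qed

text \<open>The old marks remain \<open>j\<close>-runs because \<open>i\<close> is a gap, and the
  inserted run becomes an additional mark.\<close>

lemma marked_insert:
  assumes PS: "(P, S) \<in> marked j F m r k" and i: "i \<in> gaps j S (m + r)" and l: "0 < l"
  shows "(insert_run (j * i) (j * l) P,
      insert (interval_block (j * i) (j * l)) (map (shift_up (j * i) (j * l)) ` S))
    \<in> marked j F m (r + l) (Suc k)"
proof -
  let ?b = "interval_block (j * i) (j * l)" and ?T = "map (shift_up (j * i) (j * l)) ` S"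
  have P: "P \<in> F" "spsize j P = m + r"
    and S: "S \<subseteq> {b \<in> P. is_jrun j b}" "card S = k" "sum length S = j * r"
    using PS unfolding marked_def by auto
  have i': "i \<le> spsize j P" using i P unfolding gaps_def by simp
  have "finite S"
    using standard_spartition_finite[OF family_standard[OF P(1)]] S(1) finite_subset by fastforce
  moreover have "?b \<notin> ?T" using interval_block_notin_shift_up l j by simp
  ultimately have "card (insert ?b ?T) = Suc k" "sum length (insert ?b ?T) = j * (r + l)"
    using S(2,3) by (simp_all add: card_image[OF inj_map_shift_up] sum.reindex[OF inj_map_shift_up]
        distrib_left)
  moreover have "is_jrun j c" if "c \<in> ?T" for c
    using that is_jrun_shift_up S(1) i unfolding gaps_def by blast
  then have "insert ?b ?T \<subseteq> {b \<in> insert_run (j * i) (j * l) P. is_jrun j b}"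
    using S(1) is_jrun_interval_block[OF l] unfolding insert_run_eq by blast
  ultimately show ?thesis
    using insert_run_family[OF P(1) i' l] spsize_insert_run[OF P(1) i' l] P(2)
    unfolding marked_def by simp
qed

lemma marked_delete:
  assumes PS: "(P, S) \<in> marked j F m r (Suc k)"
    and b: "interval_block (j * i) (j * l) \<in> S" and l: "0 < l"
  defines "Q \<equiv> delete_run (interval_block (j * i) (j * l)) P"
    and "T \<equiv> map (shift_down (j * i) (j * l)) ` (S - {interval_block (j * i) (j * l)})"
  shows "l \<le> r" "(Q, T) \<in> marked j F m (r - l) k" "i \<in> gaps j T (m + r - l)"
    "insert_run (j * i) (j * l) Q = P"
    "insert (interval_block (j * i) (j * l)) (map (shift_up (j * i) (j * l)) ` T) = S"
proof -
  let ?b = "interval_block (j * i) (j * l)"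
  have P: "P \<in> F" "spsize j P = m + r"
    and S: "S \<subseteq> {b \<in> P. is_jrun j b}" "card S = Suc k" "sum length S = j * r"
    using PS unfolding marked_def by auto
  note std = family_standard[OF P(1)]
  have bP: "?b \<in> P" using b S(1) by blast
  have finS: "finite S"
    using standard_spartition_finite[OF std] S(1) finite_subset by fastforce
  have Q: "Q \<in> F"
    using F P(1) bP is_jrun_interval_block[OF l] unfolding Q_def run_closed_family_def by blast
  show insQ: "insert_run (j * i) (j * l) Q = P"
    unfolding Q_def by (rule insert_delete_run[OF std bP])
  have upT: "map (shift_up (j * i) (j * l)) ` T = S - {?b}"
    unfolding T_def using S(1) by (intro shift_up_down_image[OF std bP]) blast
  then show "insert ?b (map (shift_up (j * i) (j * l)) ` T) = S"
    using b by blast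
  have cards: "card (S - {?b}) = card T" "sum length (S - {?b}) = sum length T"
    unfolding upT[symmetric]
    by (simp_all add: card_image[OF inj_map_shift_up] sum.reindex[OF inj_map_shift_up])
  have cardT: "card T = k"
    using cards(1) b finS S(2) by simp
  have sumT: "sum length T + j * l = j * r"
    using cards(2) sum.remove[OF finS b, of length] S(3) by simp
  then have "j * l \<le> j * r" by linarith
  then show lr: "l \<le> r" using j by simp
  have sumT': "sum length T = j * (r - l)"
    using sumT by (simp add: diff_mult_distrib2)
  \<comment> \<open>The size of \<open>Q\<close> is found by inserting the run again, which gives
    \<open>P\<close>.\<close>
  have "j * l + card (entries Q) = card (entries P)"
    using card_entries_insert_run[of Q "j * i" "j * l"] insQ std family_standard[OF Q] l j by simp
  then have "j * (l + spsize j Q) = j * (m + r)"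
    using P(2) by (simp add: card_entries_family[OF Q] card_entries_family[OF P(1)] distrib_left)
  then have sizeQ: "l + spsize j Q = m + r" using j by simp
  \<comment> \<open>The last entry of the deleted run is an entry of \<open>P\<close>; this bounds
    \<open>i\<close> by the size of \<open>Q\<close>.\<close>
  have "j * i + j * l \<in> entries P"
    using bP l j unfolding entries_def by (force simp: set_interval_block)
  then have "j * (i + l) \<le> j * (m + r)"
    using standard_spartition_entries[OF std] P(2)
    by (simp add: card_entries_family[OF P(1)] distrib_left)
  then have i: "i \<le> m + r - l" using j by simp
  have run: "is_jrun j c \<and> \<not> (j * i \<in> set c \<and> j * i + 1 \<in> set c)" if "c \<in> T" for c
  proof -
    obtain d where d: "d \<in> S - {?b}" "c = map (shift_down (j * i) (j * l)) d"
      using \<open>c \<in> T\<close> unfolding T_def by blast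
    have "set d \<inter> {j * i<..j * i + j * l} = {}"
      using standard_spartition_disjoint[OF std _ bP, of d] d(1) S(1)
      by (auto simp: set_interval_block)
    then show ?thesis
      using is_jrun_shift_down[of d i l] d S(1) l by blast
  qed
  then show "i \<in> gaps j T (m + r - l)"
    using i unfolding gaps_def by blast
  have "T \<subseteq> Q"
    using S(1) unfolding T_def Q_def delete_run_eq[OF std bP] by blast
  with run Q cardT sumT' sizeQ lr show "(Q, T) \<in> marked j F m (r - l) k"
    unfolding marked_def by auto
qed

section \<open>Counting marked pairs\<close>

lemma finite_marked: "finite (marked j F m r k)"
proof (rule finite_subset)
  let ?L = "{P \<in> F. spsize j P = m + r}"
  show "marked j F m r k \<subseteq> Sigma ?L Pow"
    unfolding marked_def by auto
  show "finite (Sigma ?L Pow)"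
    using finite_spsize_level[OF j family_standard] standard_spartition_finite family_standard
    by (intro finite_SigmaI) auto
qed

text \<open>The target consists of marked pairs with one mark distinguished. Deleting that run
  leaves its size \<open>l\<close>, a pair with one mark fewer, and the gap \<open>i\<close> where
  the run was.\<close>

lemma bij_betw_marked:
  "bij_betw (\<lambda>(l, (P, S), i). ((insert_run (j * i) (j * l) P,
        insert (interval_block (j * i) (j * l)) (map (shift_up (j * i) (j * l)) ` S)),
        interval_block (j * i) (j * l)))
     (SIGMA l:{1..r}. SIGMA t:marked j F m (r - l) k. gaps j (snd t) (m + r - l))
     (SIGMA t:marked j F m r (Suc k). snd t)"
  (is "bij_betw ?h ?A ?B")
proof (rule bij_betwI[where g = "\<lambda>((P, S), b).
     let l = length b div j; i = (hd b - 1) div j in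
     (l, (delete_run b P, map (shift_down (j * i) (j * l)) ` (S - {b})), i)"])
  let ?g = "\<lambda>((P, S), b).
     let l = length b div j; i = (hd b - 1) div j in
     (l, (delete_run b P, map (shift_down (j * i) (j * l)) ` (S - {b})), i)"
  \<comment> \<open>The run at place \<open>i\<close> starts with \<open>j * i + 1\<close>, hence
    the subtraction of 1 when \<open>i\<close> is recovered from the head.\<close>
  have g: "?g ((P, S), interval_block (j * i) (j * l)) =
      (l, (delete_run (interval_block (j * i) (j * l)) P,
        map (shift_down (j * i) (j * l)) ` (S - {interval_block (j * i) (j * l)})), i)"
    if "0 < l" for P S i l
    using j that by (simp add: Let_def hd_interval_block)
  show "?h \<in> ?A \<rightarrow> ?B"
  proof
    fix x assume "x \<in> ?A"
    then obtain l P S i where x: "x = (l, (P, S), i)" "1 \<le> l" "l \<le> r"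
      and PS: "(P, S) \<in> marked j F m (r - l) k" and i: "i \<in> gaps j S (m + r - l)"
      by auto
    have "i \<in> gaps j S (m + (r - l))" using i x(3) by simp
    from marked_insert[OF PS this, of l] show "?h x \<in> ?B"
      using x by simp
  qed
  have B: thesis if "y \<in> ?B" "\<And>P S i l. y = ((P, S), interval_block (j * i) (j * l)) \<Longrightarrow>
      (P, S) \<in> marked j F m r (Suc k) \<Longrightarrow> interval_block (j * i) (j * l) \<in> S \<Longrightarrow>
      0 < l \<Longrightarrow> thesis" for y thesis
  proof -
    obtain P S b where y: "y = ((P, S), b)" by (metis prod.collapse)
    then have PS: "(P, S) \<in> marked j F m r (Suc k)" "b \<in> S"
      using that(1) by simp_all
    then have "is_jrun j b" unfolding marked_def by auto
    then obtain i l where l: "0 < l" and b: "b = interval_block (j * i) (j * l)"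
      using is_jrun_iff[OF j] by blast
    show thesis
      by (rule that(2)[OF y[unfolded b] PS(1) PS(2)[unfolded b] l])
  qed
  show "?g \<in> ?B \<rightarrow> ?A"
  proof
    fix y assume "y \<in> ?B"
    then obtain P S i l where y: "y = ((P, S), interval_block (j * i) (j * l))"
      and PS: "(P, S) \<in> marked j F m r (Suc k)" "interval_block (j * i) (j * l) \<in> S" "0 < l"
      by (rule B)
    show "?g y \<in> ?A"
      using marked_delete(1-3)[OF PS] PS(3) unfolding y g[OF PS(3)] by simp
  qed
  show "?h (?g y) = y" if yB: "y \<in> ?B" for y
  proof -
    obtain P S i l where y: "y = ((P, S), interval_block (j * i) (j * l))"
      and PS: "(P, S) \<in> marked j F m r (Suc k)" "interval_block (j * i) (j * l) \<in> S" "0 < l"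
      using yB by (rule B)
    show ?thesis
      unfolding y g[OF PS(3)] using marked_delete(4,5)[OF PS] by simp
  qed
  show "?g (?h x) = x" if xA: "x \<in> ?A" for x
  proof -
    obtain l P S i where x: "x = (l, (P, S), i)" "1 \<le> l" "l \<le> r"
      and PS: "(P, S) \<in> marked j F m (r - l) k" and i: "i \<in> gaps j S (m + r - l)"
      using xA by auto
    have PF: "P \<in> F" "i \<le> spsize j P"
      using PS i x(3) unfolding marked_def gaps_def by auto
    have l: "0 < l" "0 < j * l" using x(2) j by auto
    have h: "?h x = ((insert_run (j * i) (j * l) P,
        insert (interval_block (j * i) (j * l)) (map (shift_up (j * i) (j * l)) ` S)),
        interval_block (j * i) (j * l))"
      by (simp add: x(1))
    have "map (shift_down (j * i) (j * l)) ` (insert (interval_block (j * i) (j * l))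
        (map (shift_up (j * i) (j * l)) ` S) - {interval_block (j * i) (j * l)}) = S"
      using interval_block_notin_shift_up[OF l(2), of "j * i" S]
      by (simp add: image_image del: map_map)
    then show ?thesis
      using delete_insert_run[OF family_standard[OF insert_run_family[OF PF l(1)]] l(2)]
      unfolding h g[OF l(1)] by (simp only: x(1))
  qed
qed

text \<open>Both sides of the bijection are counted: there are \<open>Suc k\<close> choices of the
  distinguished mark, and each smaller pair has \<open>Suc (m + k)\<close> gaps by
  \<open>card_gaps\<close>.\<close>

lemma card_marked_Suc:
  "Suc k * card (marked j F m r (Suc k)) = Suc (m + k) * (\<Sum>l=1..r. card (marked j F m (r - l) k))"
proof -
  have marks: "card (snd t) = k' \<and> finite (snd t)" if "t \<in> marked j F m r k'" for t r k'
    using that standard_spartition_finite[OF family_standard] finite_subset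
    unfolding marked_def by fastforce
  have gaps: "card (gaps j (snd t) (m + r - l)) = Suc (m + k)"
    if "l \<in> {1..r}" "t \<in> marked j F m (r - l) k" for t l
  proof -
    obtain P S where t: "t = (P, S)" by fastforce
    have "card (gaps j S (m + (r - l))) = Suc (m + card S)"
      using that unfolding t marked_def
      by (intro card_gaps[OF j, of P]) (auto simp: family_standard card_entries_family)
    then show ?thesis using marks[of t "r - l" k] that t by simp
  qed
  have "card (SIGMA t:marked j F m r (Suc k). snd t) = Suc k * card (marked j F m r (Suc k))"
    using marks[of _ r "Suc k"] by (subst card_SigmaI) (auto simp: finite_marked)
  moreover have "card (SIGMA l:{1..r}. SIGMA t:marked j F m (r - l) k. gaps j (snd t) (m + r - l))
      = (\<Sum>l=1..r. card (marked j F m (r - l) k) * Suc (m + k))"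
    using gaps by (subst card_SigmaI; (subst card_SigmaI)?) (auto simp: finite_marked gaps_def)
  ultimately show ?thesis
    using bij_betw_same_card[OF bij_betw_marked[of r m k]]
    by (simp add: sum_distrib_left mult.commute)
qed

lemma card_marked_0:
  "card (marked j F m r 0) = (if r = 0 then card {P \<in> F. spsize j P = m} else 0)"
proof -
  have fin: "finite S" if "P \<in> F" "S \<subseteq> {b \<in> P. is_jrun j b}" for P S
    using standard_spartition_finite[OF family_standard[OF that(1)]] that(2) finite_subset
    by fastforce
  have "marked j F m r 0 = (if r = 0 then (\<lambda>P. (P, {})) ` {P \<in> F. spsize j P = m} else {})"
    using j fin unfolding marked_def by (auto simp: card_eq_0_iff)
  then show ?thesis by (simp add: card_image inj_on_def)
qed

lemma card_marked:
  "card (marked j F m r k) = card {P \<in> F. spsize j P = m} * (((m + k) choose k) * ncomp r k)"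
proof (induction k arbitrary: r)
  case 0
  then show ?case by (simp add: card_marked_0)
next
  case (Suc k)
  let ?f = "card {P \<in> F. spsize j P = m}"
  have "Suc k * card (marked j F m r (Suc k))
      = (Suc (m + k) * ((m + k) choose k)) * (?f * ncomp r (Suc k))"
    unfolding card_marked_Suc Suc.IH
    by (simp add: sum_distrib_left sum_distrib_right mult_ac del: mult_Suc)
  \<comment> \<open>Absorption identity for binomial coefficients; the common factor
    \<open>Suc k\<close> then cancels.\<close>
  also have "\<dots> = Suc k * (?f * ((Suc (m + k) choose Suc k) * ncomp r (Suc k)))"
    unfolding Suc_times_binomial_eq by (simp only: mult_ac)
  finally show ?case by (simp del: mult_Suc binomial_Suc_Suc ncomp.simps)
qed

text \<open>Expanding the power of \<open>z + 1\<close> chooses which \<open>j\<close>-runs are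
  marked. The marked pairs are then grouped by marked size \<open>r\<close> and number of marks
  \<open>k\<close>.\<close>

lemma sum_marked:
  fixes z :: "'a::comm_ring_1"
  shows "(\<Sum>P | P \<in> F \<and> spsize j P = n. (z + 1) ^ num_jruns j P)
    = (\<Sum>r\<le>n. \<Sum>k\<le>n. of_nat (card (marked j F (n - r) r k)) * z ^ k)"
proof -
  define L where "L = {P \<in> F. spsize j P = n}"
  define D where "D = Sigma L (\<lambda>P. Pow {b \<in> P. is_jrun j b})"
  have finL: "finite L"
    unfolding L_def by (rule finite_spsize_level[OF j family_standard])
  have finP: "finite P" if "P \<in> L" for P
    using that standard_spartition_finite[OF family_standard] unfolding L_def by blast
  have finD: "finite D"
    unfolding D_def using finL finP by (intro finite_SigmaI) auto
  \<comment> \<open>Each run has length at least \<open>j\<close>, so \<open>k\<close> marks have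
    size at least \<open>k\<close>. This places both indices in \<open>{..n}\<close>.\<close>
  have D: "\<exists>r. sum length S = j * r \<and> card S \<le> r \<and> r \<le> n" if "(P, S) \<in> D" for P S
  proof -
    have P: "P \<in> F" "spsize j P = n" "P \<in> L" and S: "S \<subseteq> P" "\<forall>b\<in>S. is_jrun j b"
      using that unfolding D_def L_def by auto
    have "j dvd sum length S"
      using S(2) unfolding is_jrun_def by (intro dvd_sum) blast
    then obtain r where r: "sum length S = j * r" by blast
    have "j \<le> length b" if "b \<in> S" for b
      using S(2) that is_jrun_iff[OF j, of b] by auto
    then have "card S * j \<le> j * r"
      using sum_bounded_below[of S j length] r by simp
    then have "card S \<le> r" using j by (simp add: mult.commute)
    moreover have "sum length S \<le> sum length P"
      using S(1) finP[OF P(3)] by (intro sum_mono2) auto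
    then have "j * r \<le> j * n"
      using card_entries[OF family_standard[OF P(1)]] card_entries_family[OF P(1)] P(2) r by simp
    ultimately show ?thesis using r j by auto
  qed
  define g where "g = (\<lambda>(P :: nat list set, S :: nat list set). (sum length S div j, card S))"
  have "(\<Sum>P\<in>L. (z + 1) ^ num_jruns j P) = (\<Sum>P\<in>L. \<Sum>S\<in>Pow {b \<in> P. is_jrun j b}. z ^ card S)"
    unfolding num_jruns_def
    using finP prod_add[of "{b \<in> P. is_jrun j b}" "\<lambda>_. z" "\<lambda>_. 1" for P]
    by (intro sum.cong) simp_all
  also have "\<dots> = (\<Sum>(P, S)\<in>D. z ^ card S)"
    unfolding D_def using finL finP by (subst sum.Sigma) auto
  also have "\<dots> = (\<Sum>x\<in>{..n} \<times> {..n}. \<Sum>(P, S)\<in>{t \<in> D. g t = x}. z ^ card S)"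
  proof (rule sum.group[symmetric])
    show "g ` D \<subseteq> {..n} \<times> {..n}"
    proof (rule image_subsetI)
      fix t assume "t \<in> D"
      moreover obtain P S where t: "t = (P, S)" by fastforce
      ultimately obtain r where "sum length S = j * r" "card S \<le> r" "r \<le> n"
        using D by blast
      then show "g t \<in> {..n} \<times> {..n}" using j by (simp add: t g_def)
    qed
  qed (use finD in simp_all)
  also have "\<dots> = (\<Sum>(r, k)\<in>{..n} \<times> {..n}. of_nat (card (marked j F (n - r) r k)) * z ^ k)"
  proof (intro sum.cong refl, clarify)
    fix r k assume "r \<le> n"
    have "{t \<in> D. g t = (r, k)} = marked j F (n - r) r k"
    proof (intro equalityI subsetI)
      fix t assume t: "t \<in> {t \<in> D. g t = (r, k)}"
      obtain P S where PS: "t = (P, S)" by fastforce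
      then obtain r' where "sum length S = j * r'" using D t by blast
      then have "sum length S = j * r" using t j by (simp add: PS g_def)
      then show "t \<in> marked j F (n - r) r k"
        using t \<open>r \<le> n\<close> unfolding PS D_def L_def g_def marked_def by auto
    next
      fix t assume "t \<in> marked j F (n - r) r k"
      then show "t \<in> {t \<in> D. g t = (r, k)}"
        using j \<open>r \<le> n\<close> unfolding D_def L_def g_def marked_def by auto
    qed
    moreover have "(\<Sum>(P, S)\<in>marked j F (n - r) r k. z ^ card S)
        = (\<Sum>t\<in>marked j F (n - r) r k. z ^ k)"
      by (intro sum.cong refl) (auto simp: marked_def)
    ultimately show "(\<Sum>(P, S)\<in>{t \<in> D. g t = (r, k)}. z ^ card S)
        = of_nat (card (marked j F (n - r) r k)) * z ^ k"
      by simp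
  qed
  finally show ?thesis
    unfolding L_def sum.cartesian_product .
qed

end

theorem theorem15:
  fixes j :: nat and F :: "nat list set set"
  assumes "0 < j"
    and "run_closed_family j F"
  shows "run_transform (size_gf j F) = weighted_gf j F (\<lambda>P. yvar ^ num_jruns j P)"
proof (rule fps_ext)
  fix n
  define A where "A = (1 - fps_X) * inv_one_minus_xy"
  define f where "f m = card {P \<in> F. spsize j P = m}" for m
  \<comment> \<open>The inner series of the transform is \<open>x * A\<close>, with the same
    \<open>A\<close> as the prefactor.\<close>
  have "fps_nth (run_transform (size_gf j F)) n
      = fps_nth (A * (Abs_fps (\<lambda>n. [:fps_nth (size_gf j F) n:]) oo (fps_X * A))) n"
    unfolding run_transform_def A_def by (simp only: mult.assoc)
  also have "\<dots> = (\<Sum>m\<le>n. of_nat (f m) * fps_nth (A ^ Suc m) (n - m))"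
    unfolding fps_mult_compose_nth size_gf_def weighted_gf_def f_def
    by (simp add: of_nat_poly)
  \<comment> \<open>The index becomes the marked size \<open>r\<close>, with a remainder of size
    \<open>n - r\<close>.\<close>
  also have "\<dots> = (\<Sum>r\<le>n. of_nat (f (n - r)) * fps_nth (A ^ Suc (n - r)) r)"
    by (rule sum.reindex_bij_witness[of _ "\<lambda>r. n - r" "\<lambda>r. n - r"]) auto
  also have "\<dots> = (\<Sum>r\<le>n. \<Sum>k\<le>n. of_nat (card (marked j F (n - r) r k)) * (yvar - 1) ^ k)"
  proof (intro sum.cong refl)
    fix r assume "r \<in> {..n}"
    then have "fps_nth (A ^ Suc (n - r)) r
        = (\<Sum>k\<le>n. of_nat (((n - r + k) choose k) * ncomp r k) * (yvar - 1) ^ k)"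
      unfolding ncomp_series_binomial[OF run_transform_factor, folded A_def, symmetric]
      by (intro ncomp_series_nth) simp
    then show "of_nat (f (n - r)) * fps_nth (A ^ Suc (n - r)) r
        = (\<Sum>k\<le>n. of_nat (card (marked j F (n - r) r k)) * (yvar - 1) ^ k)"
      by (simp add: card_marked[OF assms] f_def sum_distrib_left mult_ac)
  qed
  \<comment> \<open>With \<open>z = yvar - 1\<close> the base \<open>z + 1\<close> is
    \<open>yvar\<close> again.\<close>
  also have "\<dots> = fps_nth (weighted_gf j F (\<lambda>P. yvar ^ num_jruns j P)) n"
    using sum_marked[OF assms, of "yvar - 1" n] by (simp add: weighted_gf_def)
  finally show "fps_nth (run_transform (size_gf j F)) n
      = fps_nth (weighted_gf j F (\<lambda>P. yvar ^ num_jruns j P)) n" .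
qed

end
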